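(* Let $c>0$ be a constant, let $N$ be an infinite set of positive integers, and for each $n\in N$ let $P_n$ be a set of $n$ points and $L_n$ a set of $n$ lines in $\mathbb{R}^2$ with $I(P_n,L_n)\ge c\,n^{4/3}$. Let $G(P_n,L_n)$ be the graph drawing associated to $(P_n,L_n)$. Then: (1) for every function $f:N\to[0,\infty)$ with $f(n)=o(n^{2/3})$, the number of edges of $G(P_n,L_n)$ having at most $f(n)$ crossings is $o(n^{4/3})$ as $n\to\infty$ in $N$; (2) for every function $g:N\to[0,\infty)$ with $g(n)=\omega(n^{2/3})$ (i.e. $g(n)/n^{2/3}\to\infty$), the number of edges of $G(P_n,L_n)$ having at least $g(n)$ crossings is $o(n^{4/3})$ as $n\to\infty$ in $N$.
   Context: For a finite set of points $P$ and a finite set of lines $L$ in $\mathbb{R}^2$, $I(P,L)$ denotes the number of incidences, i.e. pairs $(p,\ell)\in P\times L$ with $p\in\ell$. The associated graph drawing $G(P,L)$ has vertex set $P$, and its edges are the line segments joining two consecutive points of $P$ on a line of $L$ (so a line of $L$ containing $k\ge1$ points of $P$ contributes $k-1$ edges). The number of crossings of an edge $e$ is the number of crossings on $e$ in this drawing, i.e. the number of other edges $e'$ whose relative interior meets the relative interior of $e$. *)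

theory Defs
  imports "HOL-Analysis.Analysis" "HOL-Library.Landau_Symbols"
begin

definition is_line :: "(real ^ 2) set \<Rightarrow> bool" where
  "is_line l \<longleftrightarrow> affine l \<and> aff_dim l = 1"

definition incidences :: "(real ^ 2) set \<Rightarrow> (real ^ 2) set set \<Rightarrow> nat" where
  "incidences P L = card {(p, l). p \<in> P \<and> l \<in> L \<and> p \<in> l}"

definition consecutive_on :: "(real ^ 2) set \<Rightarrow> (real ^ 2) set \<Rightarrow> real ^ 2 \<Rightarrow> real ^ 2 \<Rightarrow> bool" where
  "consecutive_on P l p q \<longleftrightarrow>
     p \<in> P \<inter> l \<and> q \<in> P \<inter> l \<and> p \<noteq> q \<and> open_segment p q \<inter> P = {}"

text \<open>An edge of the drawing is represented by the closed segment that draws it. Distinct lines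
  share at most one point, so distinct lines never contribute the same segment.\<close>

definition drawing_edges :: "(real ^ 2) set \<Rightarrow> (real ^ 2) set set \<Rightarrow> (real ^ 2) set set" where
  "drawing_edges P L = {closed_segment p q |p q. \<exists>l\<in>L. consecutive_on P l p q}"

definition crossings :: "(real ^ 2) set set \<Rightarrow> (real ^ 2) set \<Rightarrow> nat" where
  "crossings E e = card {e' \<in> E. e' \<noteq> e \<and> rel_interior e \<inter> rel_interior e' \<noteq> {}}"

text \<open>The filter of the limit \<open>n \<rightarrow> \<infinity>\<close> with \<open>n\<close> restricted to \<open>N\<close>; it is nontrivial iff \<open>N\<close> is
  infinite.\<close>

definition at_top_in :: "nat set \<Rightarrow> nat filter" where
  "at_top_in N = inf at_top (principal N)"

end

theory Submission
  imports Defs "HOL-Real_Asymp.Real_Asymp"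
begin

text \<open>
  Two lines meet at most once, so the drawing has at most \<open>n\<^sup>2\<close> (ordered) crossings; this gives (2) by
  Markov's inequality. For (1), the \<open>m\<close> edges with at most \<open>k\<close> crossings form a drawing with at most
  \<open>m k\<close> crossings, and the crossing lemma forces \<open>m = O(n (1 + sqrt k))\<close>. The crossing lemma comes from
  the linear bound \<open>m \<le> 4 n\<close> for straight-line drawings without crossings, applied to the vertices of
  one colour in a random colouring with \<open>q\<close> colours. The linear bound is a charging argument: after
  shearing to distinct abscissae, two edges that leave a vertex to the right and are consecutive in
  slope span a wedge, which is charged to its leftmost vertex; each vertex is charged at most once as
  the end of the lower edge, once as the end of the upper edge, and once otherwise.
\<close>

section \<open>Straight-line drawings without crossings\<close>

text \<open>Coordinates are arbitrary functions on the vertices, so a shear or a reflection only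
  changes \<open>x\<close> and \<open>y\<close>. Every edge is oriented to the right and is a graph
  over its abscissae; thus avoiding vertices and other edges becomes a matter of inequalities
  between affine functions of one real variable.\<close>

locale plane_edges =
  fixes x y :: "'a \<Rightarrow> real" and V :: "'a set" and D :: "('a \<times> 'a) set"
  assumes fin: "finite V" and inj: "inj_on x V"
    and edgeD: "(u, v) \<in> D \<Longrightarrow> u \<in> V \<and> v \<in> V \<and> x u < x v"
    and vertex_off: "\<lbrakk>(u, v) \<in> D; w \<in> V; x u < x w; x w < x v\<rbrakk> \<Longrightarrow>
      y w \<noteq> y u + (x w - x u) * ((y v - y u) / (x v - x u))"
    and disjoint: "\<lbrakk>(u, v) \<in> D; (u', v') \<in> D; (u, v) \<noteq> (u', v'); x u < t; t < x v; x u' < t; t < x v'\<rbrakk> \<Longrightarrow>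
      y u + (t - x u) * ((y v - y u) / (x v - x u))
      \<noteq> y u' + (t - x u') * ((y v' - y u') / (x v' - x u'))"
begin

definition slope :: "'a \<Rightarrow> 'a \<Rightarrow> real" where
  "slope u v = (y v - y u) / (x v - x u)"

definition height :: "'a \<Rightarrow> 'a \<Rightarrow> real \<Rightarrow> real" where
  "height u v t = y u + (t - x u) * slope u v"

lemma height_left: "height u v (x u) = y u"
  by (simp add: height_def)

lemma height_right: "(u, v) \<in> D \<Longrightarrow> height u v (x v) = y v"
  using edgeD[of u v] by (simp add: height_def slope_def)

lemma vertex_off_height: "\<lbrakk>(u, v) \<in> D; w \<in> V; x u < x w; x w < x v\<rbrakk> \<Longrightarrow> height u v (x w) \<noteq> y w"
  using vertex_off[of u v w] by (auto simp: height_def slope_def)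

lemma disjoint_height:
  "\<lbrakk>(u, v) \<in> D; (u', v') \<in> D; (u, v) \<noteq> (u', v'); x u < t; t < x v; x u' < t; t < x v'\<rbrakk> \<Longrightarrow>
    height u v t \<noteq> height u' v' t"
  using disjoint[of u v u' v' t] by (auto simp: height_def slope_def)

lemma x_eq: "\<lbrakk>u \<in> V; v \<in> V; x u = x v\<rbrakk> \<Longrightarrow> u = v"
  using inj by (auto dest: inj_onD)

text \<open>For equal slopes and \<open>v \<noteq> v'\<close>, the end with the smaller abscissa
  would lie inside the other edge, against \<open>vertex_off\<close>.\<close>

lemma slope_inj:
  assumes "(u, v) \<in> D" "(u, v') \<in> D" "slope u v = slope u v'"
  shows "v = v'"
proof -
  have no: "\<not> x v1 < x v2" if "(u, v1) \<in> D" "(u, v2) \<in> D" "slope u v1 = slope u v2" for v1 v2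
    using that edgeD[of u v1] vertex_off_height[of u v2 v1] height_right[of u v1]
    by (auto simp: height_def)
  show ?thesis
    using no[OF assms] no[OF assms(2,1) assms(3)[symmetric]] edgeD[OF assms(1)] edgeD[OF assms(2)]
      x_eq[of v v'] by linarith
qed

text \<open>Reflection exchanges above and below, so that \<open>descend_imp_common_end\<close>,
  which treats only one direction, also serves the second case of
  \<open>wedge_apex_differ\<close>.\<close>

lemma reflected: "plane_edges x (\<lambda>p. - y p) V D"
proof
  show "finite V" by (rule fin)
  show "inj_on x V" by (rule inj)
  show "u \<in> V \<and> v \<in> V \<and> x u < x v" if "(u, v) \<in> D" for u v
    using edgeD that by blast
  have neg: "- y u + (t - x u) * ((- y v - - y u) / (x v - x u)) =
    - (y u + (t - x u) * ((y v - y u) / (x v - x u)))" for u v t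
  proof -
    have "(- y v - - y u) / (x v - x u) = - ((y v - y u) / (x v - x u))"
      by (simp add: minus_divide_left)
    then show ?thesis by (simp add: algebra_simps)
  qed
  show "- y w \<noteq> - y u + (x w - x u) * ((- y v - - y u) / (x v - x u))"
    if "(u, v) \<in> D" "w \<in> V" "x u < x w" "x w < x v" for u v w
    using vertex_off[OF that] unfolding neg by simp
  show "- y u + (t - x u) * ((- y v - - y u) / (x v - x u)) \<noteq>
      - y u' + (t - x u') * ((- y v' - - y u') / (x v' - x u'))"
    if "(u, v) \<in> D" "(u', v') \<in> D" "(u, v) \<noteq> (u', v')" "x u < t" "t < x v" "x u' < t" "t < x v'"
    for u v u' v' t
    using disjoint[OF that] unfolding neg by simp
qed

text \<open>By the intermediate value theorem the two edges meet; for edges that neither cross nor pass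
  through vertices this can only happen at a common right end.\<close>

lemma descend_imp_common_end:
  assumes e: "(a, b) \<in> D" "(c, d) \<in> D" and w: "w \<in> V"
    and ord: "x a \<le> x c" "x c < x w" "x w \<le> x b" "x w \<le> x d"
    and start: "height a b (x c) < y c" and stop: "height c d (x w) \<le> height a b (x w)"
  shows "w = b \<and> w = d"
proof -
  define f where "f = (\<lambda>t. height c d t - height a b t)"
  have "continuous_on {x c..x w} f"
    unfolding f_def height_def by (intro continuous_intros)
  moreover have "f (x w) \<le> 0" "0 \<le> f (x c)"
    using start stop by (auto simp: f_def height_left)
  ultimately obtain t where t: "x c \<le> t" "t \<le> x w" "f t = 0"
    using IVT2'[of f "x w" 0 "x c"] ord by auto
  have "t \<noteq> x c" using start t by (auto simp: f_def height_left)
  then have tc: "x c < t" using t by simp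
  have eq: "height a b t = height c d t" using t by (simp add: f_def)
  have ne: "(a, b) \<noteq> (c, d)" using start by (auto simp: height_left)
  have V: "b \<in> V" "d \<in> V" using e edgeD by blast+
  \<comment> \<open>A meeting point interior to both edges contradicts \<open>disjoint\<close>; if
    it is the right end of only one, a vertex lies inside the other edge. Hence \<open>t\<close> is
    the abscissa of both right ends, and \<open>x w\<close> is squeezed between them and
    \<open>t\<close>.\<close>
  have "\<not> (t < x b \<and> t < x d)"
    using disjoint_height[OF e ne] eq tc ord by auto
  moreover have "\<not> (t = x b \<and> t < x d)"
    using vertex_off_height[OF e(2) V(1)] height_right[OF e(1)] eq tc by auto
  moreover have "\<not> (t = x d \<and> t < x b)"
    using vertex_off_height[OF e(1) V(2)] height_right[OF e(2)] eq tc ord by auto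
  ultimately have "x w = x b" "x w = x d" using t ord by linarith+
  then show ?thesis using x_eq V w by blast
qed

text \<open>Edges \<open>uv\<close> and \<open>uv'\<close> are consecutive in slope and \<open>w\<close> is the leftmost vertex of the closed wedge
  between the rays carrying them.\<close>

definition wedge :: "'a \<Rightarrow> 'a \<Rightarrow> 'a \<Rightarrow> 'a \<Rightarrow> bool" where
  "wedge u v v' w \<longleftrightarrow> (u, v) \<in> D \<and> (u, v') \<in> D \<and> slope u v < slope u v' \<and>
     (\<forall>v''. (u, v'') \<in> D \<longrightarrow> slope u v < slope u v'' \<longrightarrow> slope u v' \<le> slope u v'') \<and>
     w \<in> V \<and> x u < x w \<and> x w \<le> x v \<and> x w \<le> x v' \<and>
     height u v (x w) \<le> y w \<and> y w \<le> height u v' (x w) \<and>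
     (\<forall>p\<in>V. x u < x p \<longrightarrow> x p < x w \<longrightarrow> y p < height u v (x p) \<or> height u v' (x p) < y p)"

lemma finite_D: "finite D"
  by (rule finite_subset[of _ "V \<times> V"]) (use edgeD fin in auto)

lemma wedge_exists:
  assumes "(u, v) \<in> D" "(u, v0) \<in> D" "slope u v < slope u v0"
  obtains v' w where "wedge u v v' w"
proof -
  let ?S = "{v'. (u, v') \<in> D \<and> slope u v < slope u v'}"
  have "finite ?S"
    by (rule finite_subset[of _ "V"]) (use edgeD fin in auto)
  moreover have "?S \<noteq> {}" using assms by auto
  ultimately have "\<exists>v'\<in>?S. \<forall>v''\<in>?S. slope u v' \<le> slope u v''"
    using arg_min_least[of ?S _ "slope u"] arg_min_if_finite(1)[of ?S "slope u"] by blast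
  then obtain v' where v': "v' \<in> ?S" "\<And>v''. v'' \<in> ?S \<Longrightarrow> slope u v' \<le> slope u v''"
    by blast
  let ?W = "{w\<in>V. x u < x w \<and> height u v (x w) \<le> y w \<and> y w \<le> height u v' (x w)}"
  have le: "height u v t \<le> height u v' t" if "x u < t" for t
    using that v' by (simp add: height_def)
  \<comment> \<open>The nearer right end lies in the wedge. It makes \<open>?W\<close> nonempty and
    bounds the abscissa of the leftmost vertex by those of both ends.\<close>
  have W: "(if x v \<le> x v' then v else v') \<in> ?W"
    using assms(1) v' edgeD[of u v] edgeD[of u v'] height_right[of u v] height_right[of u v']
      le[of "x v"] le[of "x v'"] by auto
  then have "finite ?W" "?W \<noteq> {}" using fin by auto
  then have "\<exists>w\<in>?W. \<forall>w'\<in>?W. x w \<le> x w'"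
    using arg_min_least[of ?W _ x] arg_min_if_finite(1)[of ?W x] by blast
  then obtain w where w: "w \<in> ?W" "\<And>w'. w' \<in> ?W \<Longrightarrow> x w \<le> x w'" by blast
  have "x w \<le> x v \<and> x w \<le> x v'" using w(2)[OF W] by (auto split: if_splits)
  moreover have "y p < height u v (x p) \<or> height u v' (x p) < y p"
    if "p \<in> V" "x u < x p" "x p < x w" for p
    using w(2)[of p] that by force
  ultimately have "wedge u v v' w"
    using assms(1) v' w(1) by (auto simp: wedge_def)
  then show ?thesis by (rule that)
qed

text \<open>The vertex \<open>u2\<close> lies left of the leftmost vertex \<open>w\<close> of the
  first wedge, hence strictly above its upper edge or strictly below its lower edge. In the first
  case the lower edge of the second wedge starts above the upper edge of the first, but at
  \<open>w\<close> it is no longer above it; so both end at \<open>w\<close>. The other case is the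
  mirror image.\<close>

lemma wedge_apex_differ:
  assumes w1: "wedge u1 v1 v1' w" and w2: "wedge u2 v2 v2' w" and less: "x u1 < x u2"
  shows "w = v1' \<and> w = v2 \<or> w = v1 \<and> w = v2'"
proof -
  have "u2 \<in> V" using w2 edgeD unfolding wedge_def by blast
  then consider "height u1 v1' (x u2) < y u2" | "y u2 < height u1 v1 (x u2)"
    using w1 w2 less unfolding wedge_def by blast
  then show ?thesis
  proof cases
    case 1
    then have "w = v1' \<and> w = v2"
      using w1 w2 less by (intro descend_imp_common_end[of u1 v1' u2 v2 w]) (auto simp: wedge_def)
    then show ?thesis ..
  next
    case 2
    interpret F: plane_edges x "\<lambda>p. - y p" V D by (rule reflected)
    have neg: "F.height u v t = - height u v t" for u v t
      unfolding F.height_def height_def F.slope_def slope_def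
      by (simp add: diff_divide_distrib algebra_simps)
    have "w = v1 \<and> w = v2'"
      using w1 w2 less 2 by (intro F.descend_imp_common_end[of u1 v1 u2 v2' w]) (auto simp: wedge_def neg)
    then show ?thesis ..
  qed
qed

text \<open>Wedges at the same vertex are stacked by slope, so a common \<open>w\<close> is at most
  as high as \<open>u v1'\<close>, hence as \<open>u v2\<close>, and at least as high as
  \<open>u v2\<close>. It lies on that edge, and a vertex on an edge and right of \<open>u\<close>
  can only be its right end.\<close>

lemma wedge_same_vertex:
  assumes w1: "wedge u v1 v1' w" and w2: "wedge u v2 v2' w" and less: "slope u v1 < slope u v2"
  shows "w = v2"
proof -
  have "slope u v1' \<le> slope u v2" using w1 w2 less by (auto simp: wedge_def)
  then have "height u v1' (x w) \<le> height u v2 (x w)"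
    using w1 by (auto simp: wedge_def height_def intro!: mult_left_mono)
  then have "height u v2 (x w) = y w" using w1 w2 by (auto simp: wedge_def)
  then have "x w = x v2"
    using w2 vertex_off_height[of u v2 w] by (fastforce simp: wedge_def)
  then show ?thesis using w2 edgeD[of u v2] x_eq by (auto simp: wedge_def)
qed

lemma card_edges_le: "card D \<le> 4 * card V"
proof -
  \<comment> \<open>\<open>T\<close> consists of the steepest edge leaving each vertex and costs one
    edge per vertex. Every other edge is the lower edge of a wedge; these cost three per
    vertex.\<close>
  define T where "T = {(u, v). (u, v) \<in> D \<and> (\<forall>v'. (u, v') \<in> D \<longrightarrow> slope u v' \<le> slope u v)}"
  have T: "T \<subseteq> D" by (auto simp: T_def)
  have "inj_on fst T"
    by (auto simp: inj_on_def T_def intro!: slope_inj antisym)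
  then have cT: "card T \<le> card V"
    by (rule card_inj_on_le) (use edgeD fin in \<open>auto simp: T_def\<close>)
  have "\<exists>p. wedge (fst e) (snd e) (fst p) (snd p)" if e: "e \<in> D - T" for e
  proof -
    obtain u v where uv: "e = (u, v)" by fastforce
    then obtain v0 where "(u, v) \<in> D" "(u, v0) \<in> D" "slope u v < slope u v0"
      using e by (auto simp: T_def not_le)
    then obtain v' w where "wedge u v v' w" by (rule wedge_exists)
    then show ?thesis by (intro exI[of _ "(v', w)"]) (simp add: uv)
  qed
  then have "\<forall>e\<in>D - T. \<exists>p. wedge (fst e) (snd e) (fst p) (snd p)" by blast
  from bchoice[OF this] obtain p
    where p: "\<And>e. e \<in> D - T \<Longrightarrow> wedge (fst e) (snd e) (fst (p e)) (snd (p e))" by blast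
  \<comment> \<open>The charge records the vertex \<open>w\<close> and its role: 0 for the end of
    the lower edge, 1 for the end of the upper edge, 2 for neither.\<close>
  define k :: "'a \<times> 'a \<Rightarrow> nat" where "k = (\<lambda>e. if snd (p e) = snd e then 0 else if snd (p e) = fst (p e) then 1 else 2)"
  have "inj_on (\<lambda>e. (snd (p e), k e)) (D - T)"
  proof (rule inj_onI)
    fix e1 e2 assume e: "e1 \<in> D - T" "e2 \<in> D - T" "(snd (p e1), k e1) = (snd (p e2), k e2)"
    obtain u1 v1 u2 v2 where uv: "e1 = (u1, v1)" "e2 = (u2, v2)" by fastforce
    obtain v1' v2' w where vw: "p e1 = (v1', w)" "p e2 = (v2', w)"
      using e(3) by (cases "p e1", cases "p e2") auto
    have w: "wedge u1 v1 v1' w" "wedge u2 v2 v2' w"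
      using p[OF e(1)] p[OF e(2)] unfolding vw unfolding uv by simp_all
    have k: "k e1 = (if w = v1 then 0 else if w = v1' then 1 else 2)"
      "k e2 = (if w = v2 then 0 else if w = v2' then 1 else 2)"
      unfolding k_def vw unfolding uv by simp_all
    have ne: "v1 \<noteq> v1'" "v2 \<noteq> v2'" using w by (auto simp: wedge_def)
    have V: "u1 \<in> V" "u2 \<in> V" using w edgeD by (auto simp: wedge_def)
    have keq: "k e1 = k e2" using e(3) by simp
    \<comment> \<open>With different left vertices, \<open>w\<close> would be the upper end of one
      wedge and the lower end of the other, so the roles would differ.\<close>
    have "\<not> x u1 < x u2"
      using wedge_apex_differ[OF w] keq ne unfolding k by (auto split: if_splits)
    moreover have "\<not> x u2 < x u1"
      using wedge_apex_differ[OF w(2,1)] keq ne unfolding k by (auto split: if_splits)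
    ultimately have "u1 = u2" using x_eq[OF V] by linarith
    moreover have "v1 = v2"
    \<comment> \<open>For the edge of larger slope \<open>w\<close> has role 0; equal roles make
      \<open>w\<close> the end of the other edge too.\<close>
    proof (cases "slope u1 v1" "slope u1 v2" rule: linorder_cases)
      case less
      then have "w = v2" using wedge_same_vertex w \<open>u1 = u2\<close> by blast
      then show ?thesis using keq unfolding k by (auto split: if_splits)
    next
      case equal
      then show ?thesis using slope_inj w \<open>u1 = u2\<close> unfolding wedge_def by blast
    next
      case greater
      then have "w = v1" using wedge_same_vertex w \<open>u1 = u2\<close> by blast
      then show ?thesis using keq unfolding k by (auto split: if_splits)
    qed
    ultimately show "e1 = e2" by (simp add: uv)
  qed
  moreover have "(\<lambda>e. (snd (p e), k e)) ` (D - T) \<subseteq> V \<times> {0, 1, 2}"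
  proof (rule image_subsetI)
    fix e assume "e \<in> D - T"
    from p[OF this] have "snd (p e) \<in> V" by (auto simp: wedge_def)
    moreover have "k e \<in> {0, 1, 2}" by (simp add: k_def)
    ultimately show "(snd (p e), k e) \<in> V \<times> {0, 1, 2}" by blast
  qed
  ultimately have "card (D - T) \<le> card (V \<times> {0, 1, 2::nat})"
    by (rule card_inj_on_le) (use fin in auto)
  also have "\<dots> = 3 * card V" by (simp add: card_cartesian_product)
  finally show ?thesis
    using cT card_Diff_subset[OF finite_subset[OF T finite_D] T] card_mono[OF finite_D T] by linarith
qed

end

section \<open>Drawings on lines\<close>

lemma open_segment_on_line_iff:
  fixes a w :: "'a::real_normed_vector"
  assumes "w \<noteq> 0"
  shows "a + r *\<^sub>R w \<in> open_segment (a + s *\<^sub>R w) (a + t *\<^sub>R w) \<longleftrightarrow> s < r \<and> r < t \<or> t < r \<and> r < s"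
proof -
  have inj: "inj (\<lambda>r. r *\<^sub>R w)" using assms by (auto simp: inj_on_def)
  have "open_segment (a + s *\<^sub>R w) (a + t *\<^sub>R w) = (+) a ` (\<lambda>r. r *\<^sub>R w) ` open_segment s t"
    by (simp only: open_segment_translation open_segment_linear_image[OF linear_scaleR_left inj])
  then show ?thesis
    using assms by (auto simp: open_segment_eq_real_ivl image_iff split: if_splits)
qed

lemma line_eq_affine_hull:
  assumes "is_line l" "a \<in> l" "b \<in> l" "a \<noteq> b"
  shows "l = affine hull {a, b}"
proof -
  have "affine hull {a, b} = l"
  proof (rule affine_dim_equal)
    show "affine hull {a, b} \<subseteq> l" using assms by (intro hull_minimal) (auto simp: is_line_def)
  qed (use assms in \<open>auto simp: is_line_def\<close>)
  then show ?thesis ..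
qed

lemma lines_eq:
  assumes "is_line l" "is_line l'" "a \<in> l" "b \<in> l" "a \<in> l'" "b \<in> l'" "a \<noteq> b"
  shows "l = l'"
  using line_eq_affine_hull[of l a b] line_eq_affine_hull[of l' a b] assms by simp

text \<open>In the coordinate on the line with \<open>a\<close> at 0 and \<open>b\<close> at 1 this
  concerns two overlapping open intervals, neither containing an end of the other.\<close>

lemma collinear_segments_eq:
  assumes l: "is_line l" "a \<in> l" "b \<in> l" "c \<in> l" "d \<in> l" and ne: "a \<noteq> b"
    and z: "z \<in> open_segment a b" "z \<in> open_segment c d"
    and out: "c \<notin> open_segment a b" "d \<notin> open_segment a b" "a \<notin> open_segment c d" "b \<notin> open_segment c d"
  shows "{a, b} = {c, d}"
proof -
  define w where "w = b - a"
  have w: "w \<noteq> 0" using ne by (simp add: w_def)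
  have line: "l = range (\<lambda>u. a + u *\<^sub>R w)"
    using line_eq_affine_hull[OF l(1-3) ne] by (simp add: affine_hull_2_alt w_def)
  have ab: "a = a + 0 *\<^sub>R w" "b = a + 1 *\<^sub>R w" by (simp_all add: w_def)
  obtain s t where st: "c = a + s *\<^sub>R w" "d = a + t *\<^sub>R w" using l line by blast
  have "affine l" using l by (simp add: is_line_def)
  then have "closed_segment a b \<subseteq> l" using l by (intro closed_segment_subset affine_imp_convex)
  then have "z \<in> l" using open_closed_segment[OF z(1)] by (rule subsetD)
  then obtain r where r: "z = a + r *\<^sub>R w" using line by blast
  note iff = open_segment_on_line_iff[OF w, of a]
  have "s = 0 \<and> t = 1 \<or> s = 1 \<and> t = 0"
  proof -
    have "0 < r \<and> r < 1" "s < r \<and> r < t \<or> t < r \<and> r < s"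
      using z iff[of r 0 1] iff[of r s t] unfolding st[symmetric] r[symmetric] ab[symmetric] by auto
    moreover have "\<not> (0 < s \<and> s < 1)" "\<not> (0 < t \<and> t < 1)"
      using out(1,2) iff[of s 0 1] iff[of t 0 1] unfolding st[symmetric] ab[symmetric] by auto
    moreover have "\<not> (s < 0 \<and> 0 < t \<or> t < 0 \<and> 0 < s)" "\<not> (s < 1 \<and> 1 < t \<or> t < 1 \<and> 1 < s)"
      using out(3,4) iff[of 0 s t] iff[of 1 s t] unfolding st[symmetric] ab[symmetric] by auto
    ultimately show ?thesis by argo
  qed
  then show ?thesis using st ab(2) by auto
qed

lemma generic_shear:
  fixes S :: "(real ^ 2) set"
  assumes "finite S"
  obtains t where "inj_on (\<lambda>p. p $ 1 + t * p $ 2) S"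
proof -
  \<comment> \<open>Two points of different height get the same abscissa for exactly one
    \<open>t\<close>. Pairs of equal height only add the value 0, since division by zero gives 0;
    such points are separated by their first coordinates.\<close>
  let ?B = "(\<lambda>(p, q). (q $ 1 - p $ 1) / (p $ 2 - q $ 2)) ` (S \<times> S)"
  have "finite ?B" using assms by simp
  then obtain t where t: "t \<notin> ?B" using ex_new_if_finite[OF infinite_UNIV_char_0] by blast
  have "inj_on (\<lambda>p. p $ 1 + t * p $ 2) S"
  proof (rule inj_onI)
    fix p q assume pq: "p \<in> S" "q \<in> S" "p $ 1 + t * p $ 2 = q $ 1 + t * q $ 2"
    have "p $ 2 = q $ 2"
    proof (rule ccontr)
      assume "p $ 2 \<noteq> q $ 2"
      then have "t = (q $ 1 - p $ 1) / (p $ 2 - q $ 2)"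
        using pq(3) by (simp add: field_simps)
      then show False using t pq by force
    qed
    then show "p = q" using pq(3) by (simp add: vec_eq_iff forall_2)
  qed
  then show ?thesis by (rule that)
qed

locale line_drawing =
  fixes P :: "(real ^ 2) set" and L :: "(real ^ 2) set set"
  assumes fin_P: "finite P" and fin_L: "finite L" and line_L: "l \<in> L \<Longrightarrow> is_line l"
begin

abbreviation E :: "(real ^ 2) set set" where "E \<equiv> drawing_edges P L"

abbreviation crosses :: "(real ^ 2) set \<Rightarrow> (real ^ 2) set \<Rightarrow> bool" where
  "crosses e e' \<equiv> rel_interior e \<inter> rel_interior e' \<noteq> {}"

text \<open>Edges are bare point sets, so their ends are recovered as
  \<open>e \<inter> P\<close>.\<close>

lemma edge_cases:
  assumes "e \<in> E"
  obtains p q l where "e = closed_segment p q" "l \<in> L" "p \<in> l" "q \<in> l" "p \<in> P" "q \<in> P" "p \<noteq> q"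
    "open_segment p q \<inter> P = {}" "rel_interior e = open_segment p q" "e \<inter> P = {p, q}" "e \<subseteq> l"
proof -
  obtain p q l where *: "e = closed_segment p q" "l \<in> L" "consecutive_on P l p q"
    using assms by (auto simp: drawing_edges_def)
  then have "rel_interior e = open_segment p q"
    by (auto simp: rel_interior_closed_segment consecutive_on_def)
  moreover have "e \<inter> P = {p, q}"
    using * by (auto simp: consecutive_on_def closed_segment_eq_open)
  moreover have "e \<subseteq> l"
    using * line_L[of l] closed_segment_subset[of p l q]
    by (simp add: consecutive_on_def is_line_def affine_imp_convex)
  ultimately show ?thesis using * that by (auto simp: consecutive_on_def)
qed

lemma finite_E: "finite E"
proof (rule finite_subset)
  show "E \<subseteq> (\<lambda>(p, q). closed_segment p q) ` (P \<times> P)"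
    by (auto simp: drawing_edges_def consecutive_on_def)
qed (use fin_P in simp)

lemma same_line_crosses_eq:
  assumes "e \<in> E" "e' \<in> E" "l \<in> L" "e \<subseteq> l" "e' \<subseteq> l" "crosses e e'"
  shows "e = e'"
proof -
  from assms(1) obtain p q where e: "e = closed_segment p q" "p \<in> P" "q \<in> P" "p \<noteq> q"
    "open_segment p q \<inter> P = {}" "rel_interior e = open_segment p q" by (rule edge_cases)
  from assms(2) obtain p' q' where e': "e' = closed_segment p' q'" "p' \<in> P" "q' \<in> P"
    "open_segment p' q' \<inter> P = {}" "rel_interior e' = open_segment p' q'" by (rule edge_cases)
  obtain z where "z \<in> open_segment p q" "z \<in> open_segment p' q'" using assms(6) e(6) e'(5) by auto
  moreover have "p \<in> l" "q \<in> l" "p' \<in> l" "q' \<in> l" using assms(4,5) e(1) e'(1) by auto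
  ultimately have "{p, q} = {p', q'}"
    using e e' line_L[OF assms(3)] by (intro collinear_segments_eq[of l p q p' q' z]) auto
  then show ?thesis by (simp add: e(1) e'(1) closed_segment_eq)
qed

text \<open>A common end and the crossing point are two different points on both carrying lines, so
  the lines coincide, and then so do the edges. The sampling argument uses this to get four distinct
  ends for each crossing.\<close>

lemma crosses_ends_disjoint:
  assumes "e \<in> E" "e' \<in> E" "e \<noteq> e'" "crosses e e'"
  shows "e \<inter> P \<inter> (e' \<inter> P) = {}"
proof (rule ccontr)
  assume "e \<inter> P \<inter> (e' \<inter> P) \<noteq> {}"
  then obtain p where p: "p \<in> e" "p \<in> e'" "p \<in> P" by auto
  from assms(1) obtain l q r where e: "l \<in> L" "e \<subseteq> l" "rel_interior e = open_segment q r" "open_segment q r \<inter> P = {}"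
    by (rule edge_cases)
  from assms(2) obtain l' where e': "l' \<in> L" "e' \<subseteq> l'" by (rule edge_cases)
  obtain z where z: "z \<in> rel_interior e" "z \<in> rel_interior e'" using assms(4) by auto
  then have "z \<in> e" "z \<in> e'" using rel_interior_subset by blast+
  moreover have "z \<noteq> p" using p z e by auto
  ultimately have "l = l'" using lines_eq[of l l' p z] p e e' line_L by blast
  then show False using same_line_crosses_eq[of e e' l] assms e e' by blast
qed

text \<open>The bound is in terms of \<open>S\<close> instead of \<open>P\<close> because it is
  applied to a random sample of the points.\<close>

lemma card_noncrossing_le:
  assumes F: "F \<subseteq> E" and S: "S \<subseteq> P" and ends: "\<And>e. e \<in> F \<Longrightarrow> e \<inter> P \<subseteq> S"
    and nc: "\<And>e e'. \<lbrakk>e \<in> F; e' \<in> F; e \<noteq> e'\<rbrakk> \<Longrightarrow> \<not> crosses e e'"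
  shows "card F \<le> 4 * card S"
proof -
  have finS: "finite S" using S fin_P finite_subset by blast
  then obtain t where inj: "inj_on (\<lambda>p. p $ 1 + t * p $ 2) S" by (rule generic_shear)
  define x :: "real ^ 2 \<Rightarrow> real" where "x = (\<lambda>p. p $ 1 + t * p $ 2)"
  define y :: "real ^ 2 \<Rightarrow> real" where "y = (\<lambda>p. p $ 2)"
  define D where "D = {(u, v). u \<in> S \<and> v \<in> S \<and> x u < x v \<and> closed_segment u v \<in> F}"
  \<comment> \<open>\<open>pt u v s\<close> is the point of the line through \<open>u\<close> and
    \<open>v\<close> with sheared abscissa \<open>s\<close>. It translates equal heights in the
    locale into common points of segments.\<close>
  define pt where "pt = (\<lambda>u v s. u + ((s - x u) / (x v - x u)) *\<^sub>R (v - u))"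
  have xy: "p = q" if "x p = x q" "y p = y q" for p q
    using that by (auto simp: x_def y_def vec_eq_iff forall_2)
  have x_lin: "x (u + r *\<^sub>R (v - u)) = x u + r * (x v - x u)" for u v r
    by (simp add: x_def algebra_simps)
  have pt: "pt u v s \<in> open_segment u v" "x (pt u v s) = s"
    "y (pt u v s) = y u + (s - x u) * ((y v - y u) / (x v - x u))"
    if "x u < s" "s < x v" for u v s
  proof -
    let ?r = "(s - x u) / (x v - x u)"
    have "0 < ?r" "?r < 1" using that by auto
    moreover have "pt u v s = (1 - ?r) *\<^sub>R u + ?r *\<^sub>R v"
      by (simp add: pt_def algebra_simps)
    moreover have "u \<noteq> v" using that by auto
    ultimately show "pt u v s \<in> open_segment u v" unfolding in_segment by blast
    have "x (pt u v s) = x u + ?r * (x v - x u)"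
      unfolding pt_def by (rule x_lin)
    also have "\<dots> = s" using that by simp
    finally show "x (pt u v s) = s" .
    show "y (pt u v s) = y u + (s - x u) * ((y v - y u) / (x v - x u))"
      by (simp add: pt_def y_def)
  qed
  have DE: "open_segment u v \<inter> P = {} \<and> rel_interior (closed_segment u v) = open_segment u v"
    if "(u, v) \<in> D" for u v
  proof -
    have "closed_segment u v \<in> E" using that F by (auto simp: D_def)
    then obtain p q where "closed_segment u v = closed_segment p q" "open_segment p q \<inter> P = {}"
      by (rule edge_cases)
    then have "open_segment u v \<inter> P = {}"
      by (auto simp: doubleton_eq_iff open_segment_commute)
    then show ?thesis using that by (auto simp: D_def rel_interior_closed_segment)
  qed
  interpret plane_edges x y S D
  proof
    show "finite S" by (rule finS)
    show "inj_on x S" using inj by (simp add: x_def)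
    show "u \<in> S \<and> v \<in> S \<and> x u < x v" if "(u, v) \<in> D" for u v
      using that by (auto simp: D_def)
    show "y w \<noteq> y u + (x w - x u) * ((y v - y u) / (x v - x u))"
      if "(u, v) \<in> D" "w \<in> S" "x u < x w" "x w < x v" for u v w
    proof
      assume "y w = y u + (x w - x u) * ((y v - y u) / (x v - x u))"
      then have "pt u v (x w) = w" using pt that by (intro xy) auto
      then show False using pt(1)[OF that(3,4)] DE[OF that(1)] that(2) S by auto
    qed
    show "y u + (s - x u) * ((y v - y u) / (x v - x u)) \<noteq>
        y u' + (s - x u') * ((y v' - y u') / (x v' - x u'))"
      if "(u, v) \<in> D" "(u', v') \<in> D" "(u, v) \<noteq> (u', v')" "x u < s" "s < x v" "x u' < s" "s < x v'"
      for u v u' v' s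
    proof
      assume "y u + (s - x u) * ((y v - y u) / (x v - x u)) =
        y u' + (s - x u') * ((y v' - y u') / (x v' - x u'))"
      then have "pt u v s = pt u' v' s" using pt that by (intro xy) auto
      then have "crosses (closed_segment u v) (closed_segment u' v')"
        using pt(1)[OF that(4,5)] pt(1)[OF that(6,7)] DE that(1,2) by auto
      \<comment> \<open>A segment determines its ends up to order, and membership in
        \<open>D\<close> fixes the order.\<close>
      moreover have "closed_segment u v \<noteq> closed_segment u' v'"
        using that by (auto simp: doubleton_eq_iff)
      ultimately show False using nc that(1,2) by (auto simp: D_def)
    qed
  qed
  have "F \<subseteq> (\<lambda>(u, v). closed_segment u v) ` D"
  proof
    fix e assume e: "e \<in> F"
    then obtain p q where pq: "e = closed_segment p q" "p \<noteq> q" "e \<inter> P = {p, q}"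
      using F edge_cases by (metis subsetD)
    then have S: "p \<in> S" "q \<in> S" using ends[OF e] by auto
    then have "x p \<noteq> x q" using x_eq pq(2) by blast
    then have "(p, q) \<in> D \<or> (q, p) \<in> D"
      using S e pq by (auto simp: D_def closed_segment_commute)
    then show "e \<in> (\<lambda>(u, v). closed_segment u v) ` D"
      using pq(1) by (auto simp: closed_segment_commute intro: rev_image_eqI)
  qed
  then have "card F \<le> card D" using finite_D by (rule surj_card_le[rotated])
  also have "\<dots> \<le> 4 * card S" by (rule card_edges_le)
  finally show ?thesis .
qed
end

section \<open>The crossing lemma\<close>

text \<open>Probabilities in the sampling argument are expressed as numbers of colourings.\<close>

lemma card_functions_vanishing:
  assumes "finite V" "A \<subseteq> V" "0 < q"
  shows "real (card {h \<in> V \<rightarrow>\<^sub>E {..<q}. \<forall>a\<in>A. h a = 0}) = real q ^ card V / real q ^ card A"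
proof -
  have "{h \<in> V \<rightarrow>\<^sub>E {..<q}. \<forall>a\<in>A. h a = 0} = (\<Pi>\<^sub>E v\<in>V. if v \<in> A then {0} else {..<q})"
    using assms by (auto simp: PiE_iff extensional_def subset_iff split: if_splits)
  then have "card {h \<in> V \<rightarrow>\<^sub>E {..<q}. \<forall>a\<in>A. h a = 0} = (\<Prod>v\<in>V. if v \<in> A then 1 else q)"
    using assms by (simp add: card_PiE if_distrib[of card] cong: if_cong)
  also have "\<dots> = q ^ card (V - A)"
    using assms by (simp add: prod.If_cases Diff_eq)
  also have "card (V - A) = card V - card A"
    using assms by (simp add: card_Diff_subset finite_subset)
  finally have "card {h \<in> V \<rightarrow>\<^sub>E {..<q}. \<forall>a\<in>A. h a = 0} = q ^ (card V - card A)" .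
  moreover have "real q ^ (card V - card A) = real q ^ card V / real q ^ card A"
    using assms card_mono[OF assms(1,2)] by (intro power_diff) auto
  ultimately show ?thesis by simp
qed

context line_drawing
begin

text \<open>Colour the points with \<open>q\<close> colours uniformly at random and keep colour \<open>0\<close>: an edge survives with
  probability \<open>1/q\<^sup>2\<close>, a crossing with probability \<open>1/q\<^sup>4\<close> because its four endpoints are distinct.\<close>

lemma sampling_inequality:
  assumes F: "F \<subseteq> E" and q: "0 < q"
  shows "real (card F) * real q ^ 2 \<le>
    4 * real (card P) * real q ^ 3 + real (card {(e, e'). e \<in> F \<and> e' \<in> F \<and> e' \<noteq> e \<and> crosses e e'})"
proof -
  define X where "X = {(e, e'). e \<in> F \<and> e' \<in> F \<and> e' \<noteq> e \<and> crosses e e'}"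
  define C where "C = P \<rightarrow>\<^sub>E {..<q}"
  define Q where "Q = real q ^ card P"
  have finF: "finite F" using F finite_E finite_subset by blast
  have finX: "finite X" by (rule finite_subset[of _ "F \<times> F"]) (use finF in \<open>auto simp: X_def\<close>)
  have finC: "finite C" unfolding C_def using fin_P by (intro finite_PiE) auto
  have count: "real (card {h\<in>C. \<forall>a\<in>A. h a = 0}) = Q / real q ^ card A" if "A \<subseteq> P" for A
    using card_functions_vanishing[OF fin_P that q] by (simp add: C_def Q_def)
  \<comment> \<open>Linearity of expectation, as double counting of pairs of a colouring and a
    surviving object.\<close>
  have swap: "(\<Sum>h\<in>C. real (card {b\<in>B. \<forall>a\<in>f b. h a = 0})) = real (card B) * (Q / real q ^ k)"
    if "finite B" "\<And>b. b \<in> B \<Longrightarrow> f b \<subseteq> P \<and> card (f b) = k" for B :: "'b set" and f and k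
  proof -
    have "(\<Sum>h\<in>C. card {b\<in>B. \<forall>a\<in>f b. h a = 0}) = (\<Sum>b\<in>B. card {h\<in>C. \<forall>a\<in>f b. h a = 0})"
      using finC that(1) by (intro sum_multicount_gen) auto
    then have "(\<Sum>h\<in>C. real (card {b\<in>B. \<forall>a\<in>f b. h a = 0})) = (\<Sum>b\<in>B. real (card {h\<in>C. \<forall>a\<in>f b. h a = 0}))"
      by (simp flip: of_nat_sum)
    also have "\<dots> = (\<Sum>b\<in>B. Q / real q ^ k)"
      using that by (intro sum.cong) (auto simp: count)
    finally show ?thesis by simp
  qed
  have ends: "e \<inter> P \<subseteq> P \<and> card (e \<inter> P) = 2" if "e \<in> F" for e
  proof -
    have "e \<in> E" using that F by blast
    then obtain p q where "e \<inter> P = {p, q}" "p \<noteq> q" by (rule edge_cases)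
    then show ?thesis by auto
  qed
  have ends2: "(fst z \<union> snd z) \<inter> P \<subseteq> P \<and> card ((fst z \<union> snd z) \<inter> P) = 4" if "z \<in> X" for z
  proof -
    obtain e e' where z: "z = (e, e')" "e \<in> F" "e' \<in> F" "e \<noteq> e'" "crosses e e'"
      using \<open>z \<in> X\<close> by (auto simp: X_def)
    then have "card (e \<inter> P \<union> e' \<inter> P) = card (e \<inter> P) + card (e' \<inter> P)"
      using crosses_ends_disjoint F fin_P by (intro card_Un_disjoint) auto
    then show ?thesis using ends z by (auto simp: Int_Un_distrib2)
  qed
  have "real (card {e\<in>F. \<forall>a\<in>e \<inter> P. h a = 0}) \<le> 4 * real (card {p\<in>P. \<forall>a\<in>{p}. h a = 0}) +
      real (card {z\<in>X. \<forall>a\<in>(fst z \<union> snd z) \<inter> P. h a = 0})" for h :: "real ^ 2 \<Rightarrow> nat"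
  proof -
    let ?S = "{p\<in>P. \<forall>a\<in>{p}. h a = 0}"
    let ?FS = "{e\<in>F. \<forall>a\<in>e \<inter> P. h a = 0}"
    let ?XS = "{z\<in>X. \<forall>a\<in>(fst z \<union> snd z) \<inter> P. h a = 0}"
    \<comment> \<open>Crossing pairs are ordered, so removing their first components deletes every
      surviving edge that crosses another one. The linear bound applies to the rest.\<close>
    have "card (?FS - fst ` ?XS) \<le> 4 * card ?S"
    proof (rule card_noncrossing_le)
      show "\<not> crosses e e'" if e: "e \<in> ?FS - fst ` ?XS" "e' \<in> ?FS - fst ` ?XS" "e \<noteq> e'" for e e'
      proof
        assume "crosses e e'"
        then have "(e, e') \<in> ?XS" using e by (auto simp: X_def)
        then have "e \<in> fst ` ?XS" by (rule rev_image_eqI) simp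
        then show False using e by blast
      qed
    qed (use F in auto)
    moreover have "card (fst ` ?XS) \<le> card ?XS" using finX by (intro card_image_le) simp
    moreover have "card ?FS \<le> card (?FS - fst ` ?XS) + card (fst ` ?XS)"
      using diff_card_le_card_Diff[of "fst ` ?XS" ?FS] finX by force
    ultimately have "card ?FS \<le> 4 * card ?S + card ?XS" by linarith
    then show ?thesis by linarith
  qed
  then have "(\<Sum>h\<in>C. real (card {e\<in>F. \<forall>a\<in>e \<inter> P. h a = 0})) \<le>
    (\<Sum>h\<in>C. 4 * real (card {p\<in>P. \<forall>a\<in>{p}. h a = 0}) +
      real (card {z\<in>X. \<forall>a\<in>(fst z \<union> snd z) \<inter> P. h a = 0}))"
    by (rule sum_mono)
  then have "real (card F) * (Q / real q ^ 2) \<le>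
      4 * (real (card P) * (Q / real q ^ 1)) + real (card X) * (Q / real q ^ 4)"
    using swap[OF finF ends] swap[OF fin_P, of "\<lambda>p. {p}" 1] swap[OF finX ends2]
    by (simp add: sum.distrib sum_distrib_left[symmetric])
  \<comment> \<open>The factor \<open>q ^ 4 / Q\<close> clears all denominators.\<close>
  then have le: "(real (card F) * (Q / real q ^ 2)) * (real q ^ 4 / Q) \<le>
      (4 * (real (card P) * (Q / real q ^ 1)) + real (card X) * (Q / real q ^ 4)) * (real q ^ 4 / Q)"
    by (rule mult_right_mono) (simp add: Q_def)
  have "Q > 0" using q by (simp add: Q_def)
  then have scale: "Q / real q ^ 2 * (real q ^ 4 / Q) = real q ^ 2"
    "Q / real q ^ 1 * (real q ^ 4 / Q) = real q ^ 3" "Q / real q ^ 4 * (real q ^ 4 / Q) = 1"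
    using q by (simp_all add: field_simps eval_nat_numeral)
  show ?thesis
    using le unfolding X_def[symmetric] distrib_right mult.assoc scale by simp
qed

section \<open>Edges with few or with many crossings\<close>

lemma card_few_crossings_le:
  assumes "0 \<le> k"
  shows "real (card {e\<in>E. real (crossings E e) \<le> k}) \<le> 8 * real (card P) * (1 + sqrt (2 * k))"
proof (cases "card P = 0")
  case True
  then have "E = {}" using fin_P by (simp add: drawing_edges_def consecutive_on_def)
  then show ?thesis using True by simp
next
  case False
  define F where "F = {e\<in>E. real (crossings E e) \<le> k}"
  define m where "m = real (card F)"
  define n where "n = real (card P)"
  have n: "n > 0" using False by (simp add: n_def)
  have m0: "m \<ge> 0" by (simp add: m_def)
  have finF: "finite F" using finite_E by (simp add: F_def)
  have "{(e, e'). e \<in> F \<and> e' \<in> F \<and> e' \<noteq> e \<and> crosses e e'} =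
      (SIGMA e:F. {e'\<in>F. e' \<noteq> e \<and> crosses e e'})" by auto
  then have "real (card {(e, e'). e \<in> F \<and> e' \<in> F \<and> e' \<noteq> e \<and> crosses e e'}) =
      (\<Sum>e\<in>F. real (card {e'\<in>F. e' \<noteq> e \<and> crosses e e'}))"
    using finF by simp
  also have "\<dots> \<le> (\<Sum>e\<in>F. k)"
  proof (rule sum_mono)
    fix e assume e: "e \<in> F"
    have "card {e'\<in>F. e' \<noteq> e \<and> crosses e e'} \<le> crossings E e"
      unfolding crossings_def using finite_E by (intro card_mono) (auto simp: F_def)
    then show "real (card {e'\<in>F. e' \<noteq> e \<and> crosses e e'}) \<le> k" using e by (simp add: F_def)
  qed
  finally have X: "real (card {(e, e'). e \<in> F \<and> e' \<in> F \<and> e' \<noteq> e \<and> crosses e e'}) \<le> m * k"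
    by (simp add: m_def)
  \<comment> \<open>With \<open>q \<le> m / (8 * n)\<close> the term \<open>4 * n * q ^ 3\<close> is
    at most half of \<open>m * q ^ 2\<close>, so \<open>m * k\<close> must cover the other half and
    \<open>q ^ 2 \<le> 2 * k\<close>. Rounding down costs the summand 1 in the bound.\<close>
  define q where "q = nat \<lfloor>m / (8 * n)\<rfloor>"
  have q: "real q \<le> m / (8 * n)" "m / (8 * n) < real q + 1"
    using m0 n by (simp_all add: q_def)
  have "real q \<le> sqrt (2 * k)"
  proof (cases "q = 0")
    case False
    then have "m * real q ^ 2 \<le> 4 * n * real q ^ 3 + m * k"
      using sampling_inequality[of F q] X by (simp add: F_def m_def n_def)
    moreover have "8 * n * real q \<le> m" using q n by (simp add: field_simps)
    then have "8 * n * real q * real q ^ 2 \<le> m * real q ^ 2" by (rule mult_right_mono) simp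
    then have "8 * n * real q ^ 3 \<le> m * real q ^ 2" by (simp add: eval_nat_numeral)
    ultimately have "m * real q ^ 2 \<le> m * (2 * k)" by linarith
    moreover have "m > 0" using \<open>8 * n * real q \<le> m\<close> n False
      by (smt (verit) mult_pos_pos of_nat_0_less_iff gr0I)
    ultimately have "real q ^ 2 \<le> 2 * k" by simp
    then show ?thesis by (rule real_le_rsqrt)
  qed (use assms in simp)
  then have "m / (8 * n) \<le> 1 + sqrt (2 * k)" using q by linarith
  then have "m \<le> 8 * n * (1 + sqrt (2 * k))" using n by (simp add: field_simps)
  then show ?thesis by (simp add: m_def n_def F_def)
qed

text \<open>A crossing pair of edges is sent to the pair of their lines. These are distinct and meet
  in one point only, and on each line at most one edge has that point in its interior; so the map is
  injective.\<close>

lemma sum_crossings_le: "(\<Sum>e\<in>E. crossings E e) \<le> card L ^ 2"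
proof -
  have "\<forall>e\<in>E. \<exists>l. l \<in> L \<and> e \<subseteq> l"
  proof
    fix e assume "e \<in> E"
    then obtain l where "l \<in> L" "e \<subseteq> l" by (rule edge_cases)
    then show "\<exists>l. l \<in> L \<and> e \<subseteq> l" by blast
  qed
  from bchoice[OF this] obtain f where f: "\<And>e. e \<in> E \<Longrightarrow> f e \<in> L \<and> e \<subseteq> f e" by blast
  let ?X = "SIGMA e:E. {e'\<in>E. e' \<noteq> e \<and> crosses e e'}"
  have "inj_on (\<lambda>(e, e'). (f e, f e')) ?X"
  proof (rule inj_onI, clarify)
    fix e1 e1' e2 e2'
    assume E: "e1 \<in> E" "e1' \<in> E" "e2 \<in> E" "e2' \<in> E" and ne: "e1' \<noteq> e1" "e2' \<noteq> e2"
      and cr: "crosses e1 e1'" "crosses e2 e2'" and eq: "f e1 = f e2" "f e1' = f e2'"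
    obtain z1 z2 where z: "z1 \<in> rel_interior e1" "z1 \<in> rel_interior e1'"
      "z2 \<in> rel_interior e2" "z2 \<in> rel_interior e2'" using cr by blast
    have "f e1 \<noteq> f e1'" using same_line_crosses_eq[of e1 e1' "f e1"] E cr ne f by metis
    moreover have "z1 \<in> f e1" "z1 \<in> f e1'" "z2 \<in> f e1" "z2 \<in> f e1'"
      using z f[OF E(1)] f[OF E(2)] f[OF E(3)] f[OF E(4)] eq rel_interior_subset by blast+
    ultimately have "z1 = z2" using lines_eq[of "f e1" "f e1'" z1 z2] line_L f E by blast
    then have "crosses e1 e2" "crosses e1' e2'" using z by auto
    then show "e1 = e2 \<and> e1' = e2'"
      using same_line_crosses_eq[of e1 e2 "f e1"] same_line_crosses_eq[of e1' e2' "f e1'"] E f eq by metis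
  qed
  then have "card ?X \<le> card (L \<times> L)"
    by (rule card_inj_on_le) (use f fin_L in auto)
  then show ?thesis using finite_E by (simp add: crossings_def card_cartesian_product power2_eq_square)
qed

lemma card_many_crossings_le:
  "real (card {e\<in>E. k \<le> real (crossings E e)}) * k \<le> real (card L) ^ 2"
proof -
  have "real (card {e\<in>E. k \<le> real (crossings E e)}) * k = (\<Sum>e\<in>{e\<in>E. k \<le> real (crossings E e)}. k)"
    by simp
  also have "\<dots> \<le> (\<Sum>e\<in>{e\<in>E. k \<le> real (crossings E e)}. real (crossings E e))"
    by (rule sum_mono) simp
  also have "\<dots> \<le> (\<Sum>e\<in>E. real (crossings E e))"
    using finite_E by (intro sum_mono2) auto
  also have "\<dots> \<le> real (card L) ^ 2"
    using of_nat_mono[OF sum_crossings_le, where 'a = real] by simp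
  finally show ?thesis .
qed

end

section \<open>Asymptotics along \<open>N\<close>\<close>

lemma eventually_at_top_in: "eventually Q (at_top_in N) \<longleftrightarrow> (\<forall>\<^sub>F n in at_top. n \<in> N \<longrightarrow> Q n)"
  by (simp add: at_top_in_def eventually_inf_principal)

theorem proposition4p2:
  fixes c :: real
    and N :: "nat set"
    and P :: "nat \<Rightarrow> (real ^ 2) set"
    and L :: "nat \<Rightarrow> (real ^ 2) set set"
  assumes "c > 0"
    and "infinite N" and "\<forall>n\<in>N. n > 0"
    and "\<forall>n\<in>N. finite (P n) \<and> card (P n) = n"
    and "\<forall>n\<in>N. finite (L n) \<and> card (L n) = n \<and> (\<forall>l\<in>L n. is_line l)"
    and "\<forall>n\<in>N. real (incidences (P n) (L n)) \<ge> c * real n powr (4/3)"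
  shows "(\<forall>f :: nat \<Rightarrow> real. (\<forall>n\<in>N. f n \<ge> 0) \<longrightarrow>
            f \<in> o[at_top_in N](\<lambda>n. real n powr (2/3)) \<longrightarrow>
            (\<lambda>n. real (card {e \<in> drawing_edges (P n) (L n).
                real (crossings (drawing_edges (P n) (L n)) e) \<le> f n}))
              \<in> o[at_top_in N](\<lambda>n. real n powr (4/3))) \<and>
         (\<forall>g :: nat \<Rightarrow> real. (\<forall>n\<in>N. g n \<ge> 0) \<longrightarrow>
            g \<in> \<omega>[at_top_in N](\<lambda>n. real n powr (2/3)) \<longrightarrow>
            (\<lambda>n. real (card {e \<in> drawing_edges (P n) (L n).
                real (crossings (drawing_edges (P n) (L n)) e) \<ge> g n}))
              \<in> o[at_top_in N](\<lambda>n. real n powr (4/3)))"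
proof (intro conjI allI impI)
  have drawing: "line_drawing (P n) (L n)" if "n \<in> N" for n
    using assms(4,5) that by unfold_locales auto
  have split43: "real n powr (4/3) = real n * real n powr (1/3)" for n
    using powr_add[of "real n" 1 "1/3"] by simp
  have split2: "real n ^ 2 = real n powr (4/3) * real n powr (2/3)" for n
    using powr_add[of "real n" "4/3" "2/3"] by simp
  {
    fix f :: "nat \<Rightarrow> real"
    assume f0: "\<forall>n\<in>N. 0 \<le> f n" and fo: "f \<in> o[at_top_in N](\<lambda>n. real n powr (2/3))"
    show "(\<lambda>n. real (card {e \<in> drawing_edges (P n) (L n).
        real (crossings (drawing_edges (P n) (L n)) e) \<le> f n}))
      \<in> o[at_top_in N](\<lambda>n. real n powr (4/3))"
    proof (rule landau_o.smallI)
      fix \<epsilon> :: real assume \<epsilon>: "\<epsilon> > 0"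
      \<comment> \<open>The two summands of \<open>8 * n * (1 + sqrt (2 * f n))\<close> each receive
        half of \<epsilon>. This asks for \<open>n \<le> \<epsilon> / 16 * n powr (4/3)\<close> and
        for \<open>sqrt (2 * f n) \<le> \<epsilon> / 16 * n powr (1/3)\<close>; squaring the latter
        gives the constant 512 = 2 * 16 * 16 below.\<close>
      have "(\<lambda>n. real n) \<in> o(\<lambda>n. real n powr (4/3))" by real_asymp
      then have "\<forall>\<^sub>F n in at_top. norm (real n) \<le> \<epsilon> / 16 * norm (real n powr (4/3))"
        by (rule landau_o.smallD) (use \<epsilon> in simp)
      then have lin: "\<forall>\<^sub>F n in at_top_in N. 8 * real n \<le> \<epsilon> / 2 * real n powr (4/3)"
        unfolding eventually_at_top_in by eventually_elim simp
      have small: "\<forall>\<^sub>F n in at_top_in N. norm (f n) \<le> \<epsilon>\<^sup>2 / 512 * norm (real n powr (2/3))"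
        by (rule landau_o.smallD[OF fo]) (use \<epsilon> in simp)
      have "\<forall>\<^sub>F n in at_top_in N. n \<in> N" by (simp add: eventually_at_top_in)
      with lin small show "\<forall>\<^sub>F n in at_top_in N.
        norm (real (card {e \<in> drawing_edges (P n) (L n). real (crossings (drawing_edges (P n) (L n)) e) \<le> f n}))
          \<le> \<epsilon> * norm (real n powr (4/3))"
      proof eventually_elim
        case (elim n)
        interpret line_drawing "P n" "L n" using drawing elim(3) .
        have "2 * f n \<le> (\<epsilon> / 16 * real n powr (1/3))\<^sup>2"
          using elim(2) powr_add[of "real n" "1/3" "1/3"] f0 elim(3)
          by (simp add: power2_eq_square mult_ac)
        then have "sqrt (2 * f n) \<le> \<epsilon> / 16 * real n powr (1/3)"
          using \<epsilon> by (intro real_le_lsqrt) auto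
        then have "8 * real n * sqrt (2 * f n) \<le> 8 * real n * (\<epsilon> / 16 * real n powr (1/3))"
          by (rule mult_left_mono) simp
        also have "\<dots> = \<epsilon> / 2 * real n powr (4/3)" by (simp add: split43)
        finally have "8 * real n * (1 + sqrt (2 * f n)) \<le> \<epsilon> * real n powr (4/3)"
          using elim(1) by (simp add: distrib_left)
        then show ?case
          using card_few_crossings_le[of "f n"] f0 assms(4) elim(3) by simp
      qed
    qed
  next
    fix g :: "nat \<Rightarrow> real"
    assume g0: "\<forall>n\<in>N. 0 \<le> g n" and go: "g \<in> \<omega>[at_top_in N](\<lambda>n. real n powr (2/3))"
    show "(\<lambda>n. real (card {e \<in> drawing_edges (P n) (L n).
        g n \<le> real (crossings (drawing_edges (P n) (L n)) e)}))
      \<in> o[at_top_in N](\<lambda>n. real n powr (4/3))"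
    proof (rule landau_o.smallI)
      fix \<epsilon> :: real assume \<epsilon>: "\<epsilon> > 0"
      \<comment> \<open>Dividing the bound \<open>n ^ 2\<close> on the number of such edges times
        \<open>g n\<close> by \<open>n powr (2/3) / \<epsilon>\<close> leaves
        \<open>\<epsilon> * n powr (4/3)\<close>.\<close>
      have large: "\<forall>\<^sub>F n in at_top_in N. norm (g n) \<ge> 1 / \<epsilon> * norm (real n powr (2/3))"
        by (rule landau_omega.smallD[OF go]) (use \<epsilon> in simp)
      have "\<forall>\<^sub>F n in at_top_in N. n \<in> N" by (simp add: eventually_at_top_in)
      with large show "\<forall>\<^sub>F n in at_top_in N.
        norm (real (card {e \<in> drawing_edges (P n) (L n). g n \<le> real (crossings (drawing_edges (P n) (L n)) e)}))
          \<le> \<epsilon> * norm (real n powr (4/3))"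
      proof eventually_elim
        case (elim n)
        interpret line_drawing "P n" "L n" using drawing elim(2) .
        let ?m = "real (card {e \<in> E. g n \<le> real (crossings E e)})"
        have pos: "real n powr (2/3) > 0" using assms(3) elim(2) by auto
        have "1 / \<epsilon> * real n powr (2/3) \<le> g n" using elim g0 by simp
        then have "?m * (1 / \<epsilon> * real n powr (2/3)) \<le> ?m * g n"
          by (rule mult_left_mono) simp
        also have "\<dots> \<le> real n ^ 2" using card_many_crossings_le assms(5) elim(2) by simp
        finally have "?m / \<epsilon> * real n powr (2/3) \<le> real n powr (4/3) * real n powr (2/3)"
          by (simp add: split2)
        then have "?m / \<epsilon> \<le> real n powr (4/3)" using pos by (rule mult_right_le_imp_le)
        then show ?case using \<epsilon> by (simp add: field_simps)
      qed
    qed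
  }
qed

end
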